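(* Let $m\ge1$ and let $a_1,\dots,a_m\in\mathbb C$. Put $a_0=0$, $a_{-j}=-a_j$ for $1\le j\le m$, and $a_s=0$ for $|s|>m$, and let $D_n=\det(a_{j-i})_{i,j=1}^n$. Then the sequence $(D_n)_{n\ge0}$ has a homogeneous constant-coefficient annihilating recurrence of degree at most $$2\cdot3^{m-1}.$$
   Context: $D_0=1$. A homogeneous constant-coefficient annihilating recurrence of degree $d$ for $(u_n)_{n\ge0}$ is a relation $u_{n+d}+c_1u_{n+d-1}+\dots+c_du_n=0$ valid for all $n\ge0$, with constants $c_1,\dots,c_d$ independent of $n$. *)

theory Defs
  imports Complex_Main "Jordan_Normal_Form.Determinant"
begin

text \<open>Matrix indices start at 0; the entries depend only on the difference of the
  indices, so this is the same matrix as with indices \<open>1, \<dots>, n\<close>. For \<open>n = 0\<close> it is the empty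
  matrix, whose determinant is 1.\<close>

definition toeplitz_mat :: "(int \<Rightarrow> 'a) \<Rightarrow> nat \<Rightarrow> 'a mat" where
  "toeplitz_mat a n = mat n n (\<lambda>(i, j). a (int j - int i))"

definition annihilating_recurrence ::
    "nat \<Rightarrow> (nat \<Rightarrow> 'a::comm_ring_1) \<Rightarrow> (nat \<Rightarrow> 'a) \<Rightarrow> bool" where
  "annihilating_recurrence d c u \<longleftrightarrow>
     (\<forall>n. u (n + d) + (\<Sum>k = 1..d. c k * u (n + d - k)) = 0)"

lemma det_toeplitz_mat_0: "det (toeplitz_mat a 0) = 1"
  by (simp add: toeplitz_mat_def)

end

theory Submission
  imports Defs "HOL-Computational_Algebra.Fundamental_Theorem_Algebra"
begin

text \<open>We may shrink \<open>m\<close> until \<open>a\<^sub>m \<noteq> 0\<close>. The polynomial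
  \<open>p(z) = \<Sum>\<^sub>k a\<^sub>k\<^sub>-\<^sub>m z\<^sup>k\<close> of degree \<open>2m\<close> is then antipalindromic, so its roots are \<open>1\<close>, \<open>-1\<close> and
  \<open>m - 1\<close> pairs \<open>r\<^sub>i\<close>, \<open>1/r\<^sub>i\<close>. If the roots are distinct, \<open>D\<^sub>n\<close> is a linear combination of \<open>n\<close>-th
  powers of \<open>(-1)\<^sup>m a\<^sub>m w\<close>, where \<open>w\<close> ranges over the products of \<open>m\<close> of the roots (Widom's
  formula). Each pair contributes \<open>1\<close>, \<open>r\<^sub>i\<close> or \<open>1/r\<^sub>i\<close> to such a product, and \<open>\<plusminus>1\<close> contributes a sign,
  so all these numbers are among the roots of a monic polynomial of degree \<open>2 \<sqdot> 3\<^sup>m\<^sup>-\<^sup>1\<close>. Its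
  coefficients and the \<open>D\<^sub>n\<close> depend continuously on the \<open>r\<^sub>i\<close>, so the recurrence persists when
  roots collide.\<close>

section \<open>Banded Toeplitz determinants and Widom's formula\<close>

text \<open>The coefficient of \<open>z^s\<close> in the Laurent polynomial
  \<open>z^(-m) p(z)\<close>. The sign test matters because \<open>nat\<close> sends negative
  integers to \<open>0\<close>.\<close>

definition laurent_coeff :: "nat \<Rightarrow> 'a::zero poly \<Rightarrow> int \<Rightarrow> 'a" where
  "laurent_coeff m p s = (if s + int m < 0 then 0 else coeff p (nat (s + int m)))"

lemma sum_coeff_eq_poly:
  fixes x :: "'a::comm_semiring_1"
  assumes "degree p < N"
  shows "(\<Sum>k<N. coeff p k * x ^ k) = poly p x"
proof -
  have "(\<Sum>k\<le>degree p. coeff p k * x ^ k) = (\<Sum>k<N. coeff p k * x ^ k)"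
    using assms by (intro sum.mono_neutral_left) (auto simp: coeff_eq_0)
  thus ?thesis by (simp add: poly_altdef)
qed

text \<open>The banded \<open>n \<times> (n + q)\<close> matrix annihilates the columns \<open>(z\<^sub>l\<^sup>k)\<^sub>k\<close>. Bordering it with
  \<open>q\<close> unit rows gives a square matrix \<open>A\<close> with determinant \<open>\<plusminus> D\<^sub>n\<close>, and multiplying by
  the matrix \<open>C\<close> made of \<open>n\<close> unit columns and these \<open>q\<close> columns makes it block triangular.\<close>

lemma det_banded_toeplitz:
  fixes p :: "'a::field poly"
  assumes deg: "degree p \<le> q" and mq: "m \<le> q"
    and roots: "\<And>l. l < q \<Longrightarrow> poly p (z l) = 0"
  shows "(- 1) ^ (n * m) * det (toeplitz_mat (laurent_coeff m p) n)
           * det (mat q q (\<lambda>(i, l). z l ^ (n + i)))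
         = coeff p 0 ^ n * det (mat q q (\<lambda>(i, l). z l ^ (if i < m then i else n + i)))"
proof -
  define B where "B i j = (if i \<le> j then coeff p (j - i) else 0)" for i j :: nat
  define N where "N = n + q"
  \<comment> \<open>The unit rows select the columns \<open>0, ..., m - 1\<close> and
    \<open>n + m, ..., N - 1\<close>. The \<open>n\<close> columns left over are those in which
    \<open>B\<close> shows the Toeplitz matrix.\<close>
  define A where "A = mat N N (\<lambda>(i, j). if i < n then B i j
      else if j = (if i < n + m then i - n else i) then 1 else 0)"
  define C where "C = mat N N (\<lambda>(i, j). if j < n then (if i = j then 1 else 0) else z (j - n) ^ i)"
  define T where "T = toeplitz_mat (laurent_coeff m p) n"
  have A: "A \<in> carrier_mat N N" and C: "C \<in> carrier_mat N N"
    and T: "T \<in> carrier_mat n n"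
    by (auto simp: A_def C_def T_def toeplitz_mat_def)
  \<comment> \<open>Moving the first \<open>m\<close> unit rows above the \<open>n\<close> banded
    rows costs the sign \<open>(-1)^(n * m)\<close> and exposes a block triangular form.\<close>
  define A2 where "A2 = mat N N (\<lambda>(i, j). A $$ (if i < m then i + n else if i < n + m then i - m else i, j))"
  have "det A = (- 1) ^ (n * m) * det A2"
    unfolding A2_def using mq by (intro det_swap_initial_rows[OF A]) (simp add: N_def)
  also have "det A2 = det T"
  proof -
    define X where "X = four_block_mat (1\<^sub>m m) (0\<^sub>m m n) (mat n m (\<lambda>(i, j). B i j)) T"
    have X: "X \<in> carrier_mat (m + n) (m + n)" unfolding X_def using T by auto
    have dT: "dim_row T = n" "dim_col T = n" using T by auto
    have "A2 = four_block_mat X (mat (m + n) (q - m) (\<lambda>(i, j). A2 $$ (i, j + (m + n))))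
                 (0\<^sub>m (q - m) (m + n)) (1\<^sub>m (q - m))"
    proof (rule eq_matI)
      fix i j
      assume "i < dim_row (four_block_mat X (mat (m + n) (q - m) (\<lambda>(i, j). A2 $$ (i, j + (m + n))))
                 (0\<^sub>m (q - m) (m + n)) (1\<^sub>m (q - m)))"
        and "j < dim_col (four_block_mat X (mat (m + n) (q - m) (\<lambda>(i, j). A2 $$ (i, j + (m + n))))
                 (0\<^sub>m (q - m) (m + n)) (1\<^sub>m (q - m)))"
      hence i: "i < N" and j: "j < N" using X mq by (auto simp: N_def)
      have T_nth: "T $$ (i, j) = B i (j + m)" if "i < n" "j < n" for i j
        using that by (auto simp: T_def toeplitz_mat_def laurent_coeff_def B_def nat_eq_iff
            intro!: arg_cong[of _ _ "coeff p"])
      have X_nth: "X $$ (i, j) = A2 $$ (i, j)" if "i < m + n" "j < m + n"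
        using that dT mq i j by (auto simp: X_def A2_def A_def N_def T_nth)
      show "A2 $$ (i, j) = four_block_mat X (mat (m + n) (q - m) (\<lambda>(i, j). A2 $$ (i, j + (m + n))))
                 (0\<^sub>m (q - m) (m + n)) (1\<^sub>m (q - m)) $$ (i, j)"
        using i j X mq X_nth by (auto simp: A2_def A_def N_def)
    qed (use X mq in \<open>auto simp: A2_def N_def\<close>)
    also have "det \<dots> = det X"
      by (subst det_four_block_mat_lower_left_zero[OF X]) auto
    also have "\<dots> = det T"
      unfolding X_def by (subst det_four_block_mat_upper_right_zero[OF _ _ _ T]) auto
    finally show ?thesis .
  qed
  finally have detA: "det A = (- 1) ^ (n * m) * det T" .
  have detC: "det C = det (mat q q (\<lambda>(i, l). z l ^ (n + i)))"
  proof -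
    have "C = four_block_mat (1\<^sub>m n) (mat n q (\<lambda>(i, j). z j ^ i)) (0\<^sub>m q n)
                (mat q q (\<lambda>(i, l). z l ^ (n + i)))"
      by (intro eq_matI) (auto simp: C_def N_def)
    thus ?thesis
      by (simp add: det_four_block_mat_lower_left_zero[where n = n and m = q])
  qed
  define L where "L = mat n n (\<lambda>(i, j). B i j)"
  define G where "G = mat q q (\<lambda>(i, l). z l ^ (if i < m then i else n + i))"
  have L: "L \<in> carrier_mat n n" and G: "G \<in> carrier_mat q q" by (auto simp: L_def G_def)
  \<comment> \<open>A banded row applied to the powers of a root \<open>z\<close> gives
    \<open>z^i * p(z) = 0\<close>, hence the zero block; the unit rows pick out the powers in
    \<open>G\<close>. The lower left block stays unevaluated, since the determinant does not involve
    it.\<close>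
  have AC: "A * C = four_block_mat L (0\<^sub>m n q) (mat q n (\<lambda>(i, j). (A * C) $$ (i + n, j))) G"
  proof (rule eq_matI)
    fix i j
    assume "i < dim_row (four_block_mat L (0\<^sub>m n q) (mat q n (\<lambda>(i, j). (A * C) $$ (i + n, j))) G)"
      and "j < dim_col (four_block_mat L (0\<^sub>m n q) (mat q n (\<lambda>(i, j). (A * C) $$ (i + n, j))) G)"
    hence i: "i < N" and j: "j < N" using L G by (auto simp: N_def)
    have AC_nth: "(A * C) $$ (i, j) = (\<Sum>k<N. A $$ (i, k) * C $$ (k, j))"
      using A C i j by (simp add: scalar_prod_def atLeast0LessThan)
    consider "i < n" "j < n" | "i < n" "j \<ge> n" | "i \<ge> n" "j < n" | "i \<ge> n" "j \<ge> n" by linarith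
    thus "(A * C) $$ (i, j)
        = four_block_mat L (0\<^sub>m n q) (mat q n (\<lambda>(i, j). (A * C) $$ (i + n, j))) G $$ (i, j)"
    proof cases
      case 1
      have "(A * C) $$ (i, j) = (\<Sum>k<N. if k = j then B i k else 0)"
        unfolding AC_nth using 1 i j by (intro sum.cong) (auto simp: A_def C_def)
      also have "\<dots> = B i j" using j by simp
      finally show ?thesis using 1 i j L G by (simp add: L_def)
    next
      case 2
      have "(A * C) $$ (i, j) = (\<Sum>k<N. B i k * z (j - n) ^ k)"
        unfolding AC_nth using 2 i j by (intro sum.cong) (auto simp: A_def C_def)
      also have "\<dots> = (\<Sum>k\<in>{i..<N}. B i k * z (j - n) ^ k)"
        by (intro sum.mono_neutral_right) (auto simp: B_def)
      also have "\<dots> = (\<Sum>k<N - i. B i (k + i) * z (j - n) ^ (k + i))"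
        by (intro sum.reindex_bij_witness[of _ "\<lambda>k. k + i" "\<lambda>k. k - i"]) auto
      also have "\<dots> = z (j - n) ^ i * (\<Sum>k<N - i. coeff p k * z (j - n) ^ k)"
        by (simp add: B_def sum_distrib_left power_add mult_ac)
      \<comment> \<open>As \<open>i < n\<close>, at least \<open>q + 1\<close> columns remain from
        column \<open>i\<close> on, so no coefficient of \<open>p\<close> is cut off.\<close>
      also have "(\<Sum>k<N - i. coeff p k * z (j - n) ^ k) = poly p (z (j - n))"
        using deg 2 by (intro sum_coeff_eq_poly) (auto simp: N_def)
      also have "\<dots> = 0" using 2 j by (intro roots) (auto simp: N_def)
      finally show ?thesis using 2 i j L G by (simp add: N_def)
    next
      case 3
      thus ?thesis using i j L G by (simp add: N_def)
    next
      case 4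
      define i' where "i' = (if i < n + m then i - n else i)"
      have i': "i' < N" using i by (auto simp: i'_def)
      have "(A * C) $$ (i, j) = (\<Sum>k<N. (if k = i' then 1 else 0) * z (j - n) ^ k)"
        unfolding AC_nth using 4 i j by (intro sum.cong) (auto simp: A_def C_def i'_def)
      also have "\<dots> = (\<Sum>k<N. if k = i' then z (j - n) ^ k else 0)"
        by (intro sum.cong) auto
      also have "\<dots> = z (j - n) ^ i'" using i' by simp
      finally show ?thesis using 4 i j L G by (auto simp: N_def G_def i'_def)
    qed
  qed (use A C L G in \<open>auto simp: N_def\<close>)
  have "det A * det C = det (A * C)" using det_mult[OF A C] by simp
  also have "\<dots> = det L * det G"
    by (subst AC, subst det_four_block_mat_upper_right_zero[OF L _ _ G]) auto
  also have "det L = prod_list (diag_mat L)"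
    by (rule det_upper_triangular[OF _ L]) (auto simp: L_def B_def upper_triangular_def)
  also have "diag_mat L = replicate n (coeff p 0)"
    by (intro nth_equalityI) (auto simp: L_def B_def diag_mat_def)
  finally show ?thesis
    by (simp add: detA detC T_def G_def)
qed

text \<open>A kernel vector of the transpose would be the coefficient list of a nonzero polynomial
  of degree below \<open>q\<close> with \<open>q\<close> distinct roots.\<close>

lemma det_vandermonde_nonzero:
  fixes z :: "nat \<Rightarrow> 'a::field"
  assumes inj: "inj_on z {..<q}"
  shows "det (mat q q (\<lambda>(i, l). z l ^ i)) \<noteq> 0"
proof
  define V where "V = mat q q (\<lambda>(l, i). z l ^ i)"
  assume "det (mat q q (\<lambda>(i, l). z l ^ i)) = 0"
  also have "mat q q (\<lambda>(i, l). z l ^ i) = V\<^sup>T" by (auto simp: V_def)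
  finally have "det V = 0" by (subst (asm) det_transpose[of _ q]) (auto simp: V_def)
  then obtain v where v: "v \<in> carrier_vec q" "v \<noteq> 0\<^sub>v q" "V *\<^sub>v v = 0\<^sub>v q"
    by (subst (asm) det_0_iff_vec_prod_zero_field[of _ q]) (auto simp: V_def)
  define P where "P = (\<Sum>i<q. monom (v $ i) i)"
  have cP: "coeff P i = (if i < q then v $ i else 0)" for i
    by (auto simp: P_def coeff_sum coeff_monom)
  have "P \<noteq> 0"
  proof
    assume "P = 0"
    hence "v $ i = 0" if "i < q" for i using cP[of i] that by simp
    hence "v = 0\<^sub>v q" using v(1) by (intro eq_vecI) auto
    thus False using v(2) by simp
  qed
  hence "degree P < q"
    by (metis cP leading_coeff_0_iff)
  have "poly P (z l) = 0" if "l < q" for l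
  proof -
    have "(V *\<^sub>v v) $ l = 0" using v(3) that by simp
    moreover have "(V *\<^sub>v v) $ l = poly P (z l)"
      using that v(1) by (simp add: V_def scalar_prod_def P_def poly_sum poly_monom atLeast0LessThan mult.commute)
    ultimately show ?thesis by simp
  qed
  hence "z ` {..<q} \<subseteq> {x. poly P x = 0}" by auto
  hence "card (z ` {..<q}) \<le> card {x. poly P x = 0}"
    using poly_roots_finite[OF \<open>P \<noteq> 0\<close>] by (intro card_mono) auto
  also have "\<dots> \<le> degree P" using card_poly_roots_bound[OF \<open>P \<noteq> 0\<close>] by simp
  finally show False using card_image[OF inj] \<open>degree P < q\<close> by simp
qed


text \<open>Both determinants of \<open>det_banded_toeplitz\<close> are expanded by Leibniz's
  formula: the shifted Vandermonde is \<open>W * Z ^ n\<close>, the one with a gap in its exponents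
  is a sum of \<open>n\<close>-th powers. Dividing gives Widom's formula, indexed by permutations
  instead of subsets of the roots.\<close>

lemma det_toeplitz_exponential_sum:
  fixes z :: "nat \<Rightarrow> 'a::field" and c :: 'a
  assumes inj: "inj_on z {..<q}" and nz: "\<And>l. l < q \<Longrightarrow> z l \<noteq> 0" and mq: "m \<le> q"
  defines "p \<equiv> smult c (\<Prod>l<q. [:- z l, 1:])"
  shows "\<exists>K. \<forall>n. det (toeplitz_mat (laurent_coeff m p) n) =
    (\<Sum>\<sigma> | \<sigma> permutes {0..<q}. K \<sigma> * ((- 1) ^ (m + q) * c * (\<Prod>i\<in>{m..<q}. z (\<sigma> i))) ^ n)"
proof -
  define W where "W = det (mat q q (\<lambda>(i, l). z l ^ i))"
  define Z where "Z = (\<Prod>l\<in>{0..<q}. z l)"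
  \<comment> \<open>The Leibniz term of the plain Vandermonde determinant, normalised by
    \<open>W\<close>; it does not depend on \<open>n\<close>.\<close>
  define K where "K \<sigma> = signof \<sigma> * (\<Prod>i\<in>{0..<q}. z (\<sigma> i) ^ i) / W" for \<sigma>
  have W: "W \<noteq> 0" unfolding W_def by (rule det_vandermonde_nonzero[OF inj])
  have Z: "Z \<noteq> 0" using nz by (auto simp: Z_def)
  have "degree (\<Prod>l<q. [:- z l, 1:]) \<le> (\<Sum>l<q. 1)"
    using degree_prod_sum_le[of "{..<q}" "\<lambda>l. [:- z l, 1:]"] by simp
  hence deg: "degree p \<le> q" unfolding p_def using degree_smult_le le_trans by fastforce
  have roots: "poly p (z l) = 0" if "l < q" for l
    using that by (auto simp: p_def poly_prod)
  have "poly p 0 = c * (\<Prod>l<q. - z l)" by (simp add: p_def poly_prod)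
  also have "(\<Prod>l<q. - z l) = (\<Prod>l<q. (- 1) * z l)" by simp
  also have "\<dots> = (- 1) ^ q * Z"
    unfolding prod.distrib by (simp add: Z_def atLeast0LessThan)
  finally have p0: "coeff p 0 = c * ((- 1) ^ q * Z)" by (simp add: poly_0_coeff_0)
  have det1: "det (mat q q (\<lambda>(i, l). z l ^ (n + i))) = W * Z ^ n" for n
  proof -
    have "det (mat q q (\<lambda>(i, l). z l ^ (n + i)))
        = (\<Sum>\<sigma> | \<sigma> permutes {0..<q}. signof \<sigma> * (\<Prod>i = 0..<q. z (\<sigma> i) ^ (n + i)))"
      by (subst det_def'[of _ q]) (auto intro!: sum.cong prod.cong)
    also have "\<dots> = (\<Sum>\<sigma> | \<sigma> permutes {0..<q}. signof \<sigma> * (\<Prod>i = 0..<q. z (\<sigma> i) ^ i) * Z ^ n)"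
    proof (intro sum.cong refl)
      fix \<sigma> assume "\<sigma> \<in> {\<sigma>. \<sigma> permutes {0..<q}}"
      hence "Z = (\<Prod>i = 0..<q. z (\<sigma> i))"
        unfolding Z_def using prod.permute[of \<sigma> "{0..<q}" z] by (simp add: o_def)
      thus "signof \<sigma> * (\<Prod>i = 0..<q. z (\<sigma> i) ^ (n + i)) = signof \<sigma> * (\<Prod>i = 0..<q. z (\<sigma> i) ^ i) * Z ^ n"
        by (simp add: power_add prod.distrib prod_power_distrib)
    qed
    also have "\<dots> = W * Z ^ n"
      unfolding W_def by (subst det_def'[of _ q]) (auto simp: sum_distrib_right intro!: sum.cong prod.cong)
    finally show ?thesis .
  qed
  have det2: "det (mat q q (\<lambda>(i, l). z l ^ (if i < m then i else n + i)))
      = W * (\<Sum>\<sigma> | \<sigma> permutes {0..<q}. K \<sigma> * (\<Prod>i\<in>{m..<q}. z (\<sigma> i)) ^ n)" for n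
  proof -
    have "det (mat q q (\<lambda>(i, l). z l ^ (if i < m then i else n + i)))
        = (\<Sum>\<sigma> | \<sigma> permutes {0..<q}. signof \<sigma> * (\<Prod>i = 0..<q. z (\<sigma> i) ^ (if i < m then i else n + i)))"
      by (subst det_def'[of _ q]) (auto intro!: sum.cong prod.cong)
    also have "\<dots> = (\<Sum>\<sigma> | \<sigma> permutes {0..<q}. W * (K \<sigma> * (\<Prod>i\<in>{m..<q}. z (\<sigma> i)) ^ n))"
    proof (intro sum.cong refl)
      fix \<sigma>
      have "(\<Prod>i = 0..<q. z (\<sigma> i) ^ (if i < m then i else n + i))
          = (\<Prod>i = 0..<q. z (\<sigma> i) ^ i * (if i \<in> {m..<q} then z (\<sigma> i) ^ n else 1))"
        by (intro prod.cong) (auto simp: power_add)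
      also have "\<dots> = (\<Prod>i = 0..<q. z (\<sigma> i) ^ i) * (\<Prod>i = 0..<q. if i \<in> {m..<q} then z (\<sigma> i) ^ n else 1)"
        by (rule prod.distrib)
      also have "(\<Prod>i = 0..<q. if i \<in> {m..<q} then z (\<sigma> i) ^ n else 1) = (\<Prod>i\<in>{m..<q}. z (\<sigma> i) ^ n)"
        by (intro prod.mono_neutral_cong_right) auto
      finally show "signof \<sigma> * (\<Prod>i = 0..<q. z (\<sigma> i) ^ (if i < m then i else n + i))
          = W * (K \<sigma> * (\<Prod>i\<in>{m..<q}. z (\<sigma> i)) ^ n)"
        using W by (simp add: K_def prod_power_distrib)
    qed
    finally show ?thesis by (simp add: sum_distrib_left)
  qed
  have "det (toeplitz_mat (laurent_coeff m p) n) =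
    (\<Sum>\<sigma> | \<sigma> permutes {0..<q}. K \<sigma> * ((- 1) ^ (m + q) * c * (\<Prod>i\<in>{m..<q}. z (\<sigma> i))) ^ n)" for n
  proof -
    define D where "D = det (toeplitz_mat (laurent_coeff m p) n)"
    define S where "S = (\<Sum>\<sigma> | \<sigma> permutes {0..<q}. K \<sigma> * (\<Prod>i\<in>{m..<q}. z (\<sigma> i)) ^ n)"
    have sq: "((- 1) ^ (n * m)) * ((- 1) ^ (n * m)) = (1 :: 'a)"
      by (simp flip: power_add add: mult_2[symmetric])
    have "(- 1) ^ (n * m) * D * (W * Z ^ n) = (c * ((- 1) ^ q * Z)) ^ n * (W * S)"
      using det_banded_toeplitz[of p q m z n, OF deg mq roots] unfolding det1 det2 p0 D_def S_def by simp
    \<comment> \<open>The constant coefficient of \<open>p\<close> contains \<open>Z\<close>, so its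
      \<open>n\<close>-th power supplies the \<open>Z ^ n\<close> that cancels the one from
      \<open>det1\<close>.\<close>
    hence "(W * Z ^ n) * ((- 1) ^ (n * m) * D) = (W * Z ^ n) * ((c * (- 1) ^ q) ^ n * S)"
      by (simp add: power_mult_distrib mult_ac)
    hence "(- 1) ^ (n * m) * D = (c * (- 1) ^ q) ^ n * S"
      using W Z by simp
    hence "((- 1) ^ (n * m) * (- 1) ^ (n * m)) * D = (- 1) ^ (n * m) * ((c * (- 1) ^ q) ^ n * S)"
      by (simp only: mult.assoc)
    hence "D = ((- 1) ^ (m + q) * c) ^ n * S"
      unfolding sq by (simp add: power_mult_distrib power_add mult_ac flip: power_mult)
    thus ?thesis by (simp add: D_def S_def sum_distrib_left power_mult_distrib mult_ac)
  qed
  thus ?thesis by blast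
qed

section \<open>From exponential sums to recurrences\<close>

text \<open>On a geometric sequence \<open>w ^ n\<close> the recurrence evaluates to
  \<open>w ^ n * P(w)\<close>, which is zero at a root; the rest is linearity. Coincidences among
  the \<open>w s\<close> do no harm.\<close>

lemma exponential_sum_annihilated:
  fixes P :: "'a::comm_ring_1 poly"
  assumes "\<And>n. u n = (\<Sum>s\<in>S. K s * w s ^ n)" and "\<And>s. s \<in> S \<Longrightarrow> poly P (w s) = 0"
  shows "(\<Sum>k\<le>degree P. coeff P k * u (n + k)) = 0"
proof -
  have "(\<Sum>k\<le>degree P. coeff P k * u (n + k))
      = (\<Sum>k\<le>degree P. \<Sum>s\<in>S. K s * w s ^ n * (coeff P k * w s ^ k))"
    by (simp add: assms(1) sum_distrib_left power_add mult_ac)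
  also have "\<dots> = (\<Sum>s\<in>S. K s * w s ^ n * poly P (w s))"
    by (subst sum.swap) (simp add: poly_altdef sum_distrib_left)
  also have "\<dots> = 0" using assms(2) by simp
  finally show ?thesis .
qed

lemma annihilating_recurrence_monic:
  assumes "lead_coeff P = 1" and "\<And>n. (\<Sum>k\<le>degree P. coeff P k * u (n + k)) = 0"
  shows "annihilating_recurrence (degree P) (\<lambda>k. coeff P (degree P - k)) u"
  unfolding annihilating_recurrence_def
proof
  fix n
  define d where "d = degree P"
  have "(\<Sum>k = 1..d. coeff P (d - k) * u (n + d - k)) = (\<Sum>k<d. coeff P k * u (n + k))"
    by (intro sum.reindex_bij_witness[of _ "\<lambda>k. d - k" "\<lambda>k. d - k"]) auto
  hence "u (n + d) + (\<Sum>k = 1..d. coeff P (d - k) * u (n + d - k)) = (\<Sum>k\<le>d. coeff P k * u (n + k))"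
    using assms(1) by (simp add: lessThan_Suc_atMost[symmetric] d_def add.commute)
  thus "u (n + degree P) + (\<Sum>k = 1..degree P. coeff P (degree P - k) * u (n + degree P - k)) = 0"
    using assms(2)[of n] by (simp add: d_def)
qed

section \<open>Paired roots and the recurrence for distinct roots\<close>

text \<open>The sequence \<open>1, -1, r\<^sub>1, 1/r\<^sub>1, r\<^sub>2, 1/r\<^sub>2, \<dots>\<close>; the value \<open>r 0\<close> is not used.\<close>

definition paired_roots :: "(nat \<Rightarrow> 'a::field) \<Rightarrow> nat \<Rightarrow> 'a" where
  "paired_roots r l = (if l div 2 = 0 then (- 1) ^ l
     else if even l then r (l div 2) else inverse (r (l div 2)))"

lemma paired_roots_even: "paired_roots r (2 * i) = (if i = 0 then 1 else r i)"
  by (simp add: paired_roots_def)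

lemma paired_roots_odd: "paired_roots r (Suc (2 * i)) = (if i = 0 then - 1 else inverse (r i))"
  by (simp add: paired_roots_def)

text \<open>What pair \<open>i\<close> can contribute to a product of roots: a sign for the pair
  \<open>1, -1\<close>, otherwise one of three values, where \<open>1\<close> stands for taking
  neither or both.\<close>

definition pair_factor :: "(nat \<Rightarrow> 'a::field) \<Rightarrow> nat \<Rightarrow> nat \<Rightarrow> 'a" where
  "pair_factor r i j = (if i = 0 then (- 1) ^ j
     else if j = 0 then 1 else if j = 1 then r i else inverse (r i))"

definition factor_choices :: "nat \<Rightarrow> (nat \<Rightarrow> nat) set" where
  "factor_choices m = (\<Pi>\<^sub>E i\<in>{..<m}. if i = 0 then {..<2} else {..<3})"

text \<open>The product runs over choices, not over distinct values, so the degree is the same for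
  every \<open>r\<close> and the coefficients vary continuously as long as no \<open>r i\<close>
  vanishes.\<close>

definition choice_poly :: "nat \<Rightarrow> 'a::field \<Rightarrow> (nat \<Rightarrow> 'a) \<Rightarrow> 'a poly" where
  "choice_poly m c r = (\<Prod>g\<in>factor_choices m. [:- (c * (\<Prod>i<m. pair_factor r i (g i))), 1:])"

definition paired_poly :: "nat \<Rightarrow> 'a::field \<Rightarrow> (nat \<Rightarrow> 'a) \<Rightarrow> 'a poly" where
  "paired_poly m c r = smult c (\<Prod>l<2 * m. [:- paired_roots r l, 1:])"

lemma finite_factor_choices: "finite (factor_choices m)"
  unfolding factor_choices_def by (intro finite_PiE) auto

lemma card_factor_choices:
  assumes "m \<ge> 1"
  shows "card (factor_choices m) = 2 * 3 ^ (m - 1)"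
proof -
  obtain k where m: "m = Suc k" using assms by (cases m) auto
  have "card (factor_choices m) = (\<Prod>i<Suc k. if i = 0 then 2 else 3)"
    unfolding factor_choices_def m by (subst card_PiE) (auto intro!: prod.cong)
  also have "\<dots> = 2 * (\<Prod>i<k. 3)"
    by (subst prod.lessThan_Suc_shift) simp
  finally show ?thesis by (simp add: m)
qed

lemma lead_coeff_choice_poly: "lead_coeff (choice_poly m c r) = 1"
  unfolding choice_poly_def by (subst lead_coeff_prod) simp

lemma degree_choice_poly: "degree (choice_poly m c r) = card (factor_choices m)"
  unfolding choice_poly_def by (subst degree_prod_eq_sum_degree) auto

text \<open>The sign \<open>s\<close> is absorbed by the factor with index 0.\<close>

lemma signed_subset_prod_eq_choice:
  fixes r :: "nat \<Rightarrow> 'a::field"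
  assumes "m \<ge> 1" and nz: "\<And>i. r i \<noteq> 0" and M: "M \<subseteq> {..<2 * m}" and s: "s \<in> {1, - 1}"
  shows "\<exists>g\<in>factor_choices m. s * (\<Prod>l\<in>M. paired_roots r l) = (\<Prod>i<m. pair_factor r i (g i))"
proof -
  define B where "B i = {l \<in> M. l div 2 = i}" for i
  define F where "F i = (\<Prod>l\<in>B i. paired_roots r l)" for i
  have block: "B i \<in> {{}, {2 * i}, {2 * i + 1}, {2 * i, 2 * i + 1}}" for i
  proof -
    have "B i \<in> Pow {2 * i, 2 * i + 1}" by (auto simp: B_def)
    thus ?thesis by (simp only: Pow_insert Pow_empty image_insert image_empty Un_iff insert_iff empty_iff) auto
  qed
  have "\<exists>j<3. F i = pair_factor r i j" if "i \<noteq> 0" for i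
  proof -
    \<comment> \<open>The full pair multiplies to \<open>1\<close>, just like the empty selection,
      so four subsets give only three values.\<close>
    have "F i = 1 \<or> F i = r i \<or> F i = inverse (r i)"
      using block[of i] unfolding insert_iff empty_iff
      by (elim disjE FalseE) (simp_all add: F_def paired_roots_even paired_roots_odd that nz)
    hence "F i = pair_factor r i 0 \<or> F i = pair_factor r i 1 \<or> F i = pair_factor r i 2"
      using that by (simp add: pair_factor_def)
    thus ?thesis
      by (elim disjE) (rule exI, rule conjI[rotated], assumption, simp)+
  qed
  then obtain g where g: "\<And>i. i \<noteq> 0 \<Longrightarrow> g i < 3 \<and> F i = pair_factor r i (g i)" by metis
  have "s * F 0 \<in> {1, - 1}"
    using block[of 0] s unfolding insert_iff empty_iff
    by (elim disjE FalseE) (simp_all add: F_def paired_roots_def)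
  then obtain j0 where j0: "j0 < 2" "s * F 0 = pair_factor r 0 j0"
    by (auto simp: pair_factor_def intro: that[of 0] that[of 1])
  \<comment> \<open>Membership in the extensional product set demands \<open>undefined\<close>
    outside \<open>{..<m}\<close>.\<close>
  define h where "h i = (if i < m then (if i = 0 then j0 else g i) else undefined)" for i
  have "h \<in> factor_choices m"
    unfolding factor_choices_def using g j0 by (auto simp: h_def PiE_def extensional_def)
  moreover have "s * (\<Prod>l\<in>M. paired_roots r l) = (\<Prod>i<m. pair_factor r i (h i))"
  proof -
    obtain k where m: "m = Suc k" using assms(1) by (cases m) auto
    have "(\<Prod>l\<in>M. paired_roots r l) = (\<Prod>i<m. F i)"
      unfolding F_def B_def using M finite_subset[OF M]
      by (intro prod.group[symmetric]) auto
    also have "s * \<dots> = (s * F 0) * (\<Prod>i<k. F (Suc i))"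
      unfolding m by (subst prod.lessThan_Suc_shift) (simp add: mult_ac)
    also have "\<dots> = pair_factor r 0 (h 0) * (\<Prod>i<k. pair_factor r (Suc i) (h (Suc i)))"
      using g j0 by (auto simp: h_def m intro!: prod.cong)
    also have "\<dots> = (\<Prod>i<m. pair_factor r i (h i))"
      unfolding m by (subst prod.lessThan_Suc_shift) simp
    finally show ?thesis .
  qed
  ultimately show ?thesis by blast
qed

text \<open>Widom's formula with \<open>q = 2 * m\<close> gives an exponential sum whose bases are
  roots of \<open>P\<close>. The coefficients are explicit, so that the identity can later pass to a
  limit.\<close>

lemma toeplitz_recurrence_generic:
  fixes r :: "nat \<Rightarrow> 'a::field" and c :: 'a
  assumes "m \<ge> 1" and nz: "\<And>i. r i \<noteq> 0" and inj: "inj_on (paired_roots r) {..<2 * m}"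
  defines "P \<equiv> choice_poly m c r"
  shows "(\<Sum>k\<le>degree P. coeff P k * det (toeplitz_mat (laurent_coeff m (paired_poly m c r)) (n + k))) = 0"
proof -
  have "\<exists>K. \<forall>n. det (toeplitz_mat (laurent_coeff m (paired_poly m c r)) n) =
    (\<Sum>\<sigma> | \<sigma> permutes {0..<2 * m}. K \<sigma> * ((- 1) ^ (m + 2 * m) * c * (\<Prod>i\<in>{m..<2 * m}. paired_roots r (\<sigma> i))) ^ n)"
    unfolding paired_poly_def using nz
    by (intro det_toeplitz_exponential_sum[OF inj]) (auto simp: paired_roots_def)
  then obtain K where K: "\<And>n. det (toeplitz_mat (laurent_coeff m (paired_poly m c r)) n) =
    (\<Sum>\<sigma> | \<sigma> permutes {0..<2 * m}. K \<sigma> * ((- 1) ^ (m + 2 * m) * c * (\<Prod>i\<in>{m..<2 * m}. paired_roots r (\<sigma> i))) ^ n)"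
    by blast
  show ?thesis
  proof (rule exponential_sum_annihilated[OF K])
    fix \<sigma> assume "\<sigma> \<in> {\<sigma>. \<sigma> permutes {0..<2 * m}}"
    hence \<sigma>: "\<sigma> permutes {0..<2 * m}" by simp
    define M where "M = \<sigma> ` {m..<2 * m}"
    have "M \<subseteq> {..<2 * m}"
      using permutes_image[OF \<sigma>] by (auto simp: M_def atLeast0LessThan[symmetric])
    moreover have "(- 1) ^ (m + 2 * m) \<in> {1, - 1 :: 'a}"
      by (cases "even m") auto
    ultimately have "\<exists>g\<in>factor_choices m. (- 1) ^ (m + 2 * m) * (\<Prod>l\<in>M. paired_roots r l)
        = (\<Prod>i<m. pair_factor r i (g i))"
      by (intro signed_subset_prod_eq_choice assms(1) nz)
    then obtain g where g: "g \<in> factor_choices m"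
      "(- 1) ^ (m + 2 * m) * (\<Prod>l\<in>M. paired_roots r l) = (\<Prod>i<m. pair_factor r i (g i))"
      by (elim bexE)
    have "(\<Prod>l\<in>M. paired_roots r l) = (\<Prod>i\<in>{m..<2 * m}. paired_roots r (\<sigma> i))"
      unfolding M_def
      by (rule prod.reindex[OF inj_on_subset[OF permutes_inj[OF \<sigma>] subset_UNIV], unfolded o_def])
    hence "(- 1) ^ (m + 2 * m) * c * (\<Prod>i\<in>{m..<2 * m}. paired_roots r (\<sigma> i))
        = c * (\<Prod>i<m. pair_factor r i (g i))"
      using g(2) by (metis mult.assoc mult.commute)
    thus "poly P ((- 1) ^ (m + 2 * m) * c * (\<Prod>i\<in>{m..<2 * m}. paired_roots r (\<sigma> i))) = 0"
      using g(1) finite_factor_choices by (auto simp: P_def choice_poly_def poly_prod)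
  qed
qed

section \<open>Continuity and colliding roots\<close>

text \<open>Induction on the number of factors: multiplying by \<open>[:- a, 1:]\<close> shifts the
  coefficients and subtracts \<open>a\<close> times the old ones.\<close>

lemma tendsto_coeff_prod_linear:
  fixes f :: "'a \<Rightarrow> 'b \<Rightarrow> 'c::real_normed_field"
  assumes "finite A" and "\<And>l. l \<in> A \<Longrightarrow> ((\<lambda>t. f t l) \<longlongrightarrow> g l) F"
  shows "((\<lambda>t. coeff (\<Prod>l\<in>A. [:- f t l, 1:]) k) \<longlongrightarrow> coeff (\<Prod>l\<in>A. [:- g l, 1:]) k) F"
  using assms
proof (induction A arbitrary: k rule: finite_induct)
  case (insert x A)
  have coeff_linear: "coeff ([:- a, 1:] * Q) k = (case k of 0 \<Rightarrow> 0 | Suc j \<Rightarrow> coeff Q j) - a * coeff Q k"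
    for a and Q :: "'c poly"
    by (simp add: coeff_pCons split: nat.split)
  have "((\<lambda>t. (case k of 0 \<Rightarrow> 0 | Suc j \<Rightarrow> coeff (\<Prod>l\<in>A. [:- f t l, 1:]) j)) \<longlongrightarrow>
         (case k of 0 \<Rightarrow> 0 | Suc j \<Rightarrow> coeff (\<Prod>l\<in>A. [:- g l, 1:]) j)) F"
    using insert by (cases k) auto
  thus ?case
    unfolding prod.insert[OF insert(1,2)] coeff_linear
    using insert by (intro tendsto_intros) auto
qed simp

lemma tendsto_det_toeplitz:
  fixes a :: "'b \<Rightarrow> int \<Rightarrow> 'c::real_normed_field"
  assumes "\<And>s. ((\<lambda>t. a t s) \<longlongrightarrow> b s) F"
  shows "((\<lambda>t. det (toeplitz_mat (a t) n)) \<longlongrightarrow> det (toeplitz_mat b n)) F"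
proof -
  have "det (toeplitz_mat x n) =
      (\<Sum>\<sigma> | \<sigma> permutes {0..<n}. signof \<sigma> * (\<Prod>i = 0..<n. x (int (\<sigma> i) - int i)))" for x :: "int \<Rightarrow> 'c"
    by (subst det_def'[of _ n]) (auto simp: toeplitz_mat_def intro!: sum.cong prod.cong)
  thus ?thesis using assms by (auto intro!: tendsto_intros)
qed

lemma eventually_poly_nonzero_at:
  fixes P :: "'a::real_normed_field poly"
  assumes "P \<noteq> 0"
  shows "eventually (\<lambda>t. poly P t \<noteq> 0) (at x)"
proof -
  have "eventually (\<lambda>t. \<forall>y\<in>{y. poly P y = 0}. t \<noteq> y) (at x)"
    using poly_roots_finite[OF assms] eventually_neq_at_within
    by (intro eventually_ball_finite) auto
  thus ?thesis by eventually_elim auto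
qed

text \<open>The case \<open>i = j\<close> of \<open>inv\<close> excludes \<open>r i = 1\<close> and
  \<open>r i = - 1\<close>, which separates each pair from the first two roots and
  \<open>r i\<close> from its own inverse.\<close>

lemma inj_on_paired_roots:
  fixes r :: "nat \<Rightarrow> 'a::field_char_0"
  assumes nz: "\<And>i. r i \<noteq> 0"
    and ne: "\<And>i j. \<lbrakk>i \<in> {1..<m}; j \<in> {1..<m}; i \<noteq> j\<rbrakk> \<Longrightarrow> r i \<noteq> r j"
    and inv: "\<And>i j. \<lbrakk>i \<in> {1..<m}; j \<in> {1..<m}\<rbrakk> \<Longrightarrow> r i * r j \<noteq> 1"
  shows "inj_on (paired_roots r) {..<2 * m}"
proof (rule inj_onI)
  fix k l assume kl: "k \<in> {..<2 * m}" "l \<in> {..<2 * m}" and eq: "paired_roots r k = paired_roots r l"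
  have r1: "r i \<noteq> 1" "r i \<noteq> - 1" if "i \<in> {1..<m}" for i
    using inv[OF that that] by auto
  have root0: "paired_roots r 0 = 1" "paired_roots r (Suc 0) = - 1"
    using paired_roots_even[of r 0] paired_roots_odd[of r 0] by simp_all
  have inverse_unit: "inverse (r i) \<noteq> 1" "inverse (r i) \<noteq> - 1" if "i \<in> {1..<m}" for i
    using r1[OF that] by (metis inverse_inverse_eq inverse_minus_eq inverse_1)+
  have inv': "r i \<noteq> inverse (r j)" "inverse (r i) \<noteq> r j" if "i \<in> {1..<m}" "j \<in> {1..<m}" for i j
    using inv[OF that] nz by (auto simp: field_simps)
  have eqD: "i = j" if "r i = r j" "i \<in> {1..<m}" "j \<in> {1..<m}" for i j
    using ne[OF that(2,3)] that(1) by blast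
  obtain i where i: "k = 2 * i \<or> k = Suc (2 * i)" by (metis evenE oddE Suc_eq_plus1)
  obtain j where j: "l = 2 * j \<or> l = Suc (2 * j)" by (metis evenE oddE Suc_eq_plus1)
  have range: "i \<in> {1..<m}" if "i \<noteq> 0" using that i kl by auto
  have range': "j \<in> {1..<m}" if "j \<noteq> 0" using that j kl by auto
  show "k = l"
  proof (cases "i = 0"; cases "j = 0")
    assume "i = 0" "j = 0"
    thus ?thesis using i j eq by (auto simp: paired_roots_def)
  next
    assume "i = 0" and j0: "j \<noteq> 0"
    thus ?thesis using i j eq r1[OF range'[OF j0]] inverse_unit[OF range'[OF j0]]
      by (auto simp: root0 paired_roots_even paired_roots_odd simp del: mult_Suc_right)
  next
    assume i0: "i \<noteq> 0" and "j = 0"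
    thus ?thesis using i j eq r1[OF range[OF i0]] inverse_unit[OF range[OF i0]]
      by (auto simp: root0 paired_roots_even paired_roots_odd simp del: mult_Suc_right)
  next
    assume i0: "i \<noteq> 0" and j0: "j \<noteq> 0"
    thus ?thesis using i j eq eqD[OF _ range[OF i0] range'[OF j0]] inv'[OF range[OF i0] range'[OF j0]]
      by (auto simp: root0 paired_roots_even paired_roots_odd simp del: mult_Suc_right)
  qed
qed

text \<open>Along the path \<open>r\<^sub>i + t i\<close> each coincidence of roots is a nonzero polynomial
  condition on \<open>t\<close>, hence fails for all small \<open>t \<noteq> 0\<close>.\<close>

lemma toeplitz_recurrence_paired:
  fixes r :: "nat \<Rightarrow> complex" and c :: complex
  assumes "m \<ge> 1" and nz: "\<And>i. r i \<noteq> 0"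
  defines "P \<equiv> choice_poly m c r"
  shows "(\<Sum>k\<le>degree P. coeff P k * det (toeplitz_mat (laurent_coeff m (paired_poly m c r)) (n + k))) = 0"
proof -
  define x where "x t i = r i + t * of_nat i" for t i
  \<comment> \<open>The default \<open>1\<close> keeps all infinitely many entries nonzero at every
    \<open>t\<close>; for each fixed \<open>i\<close> it disappears near
    \<open>t = 0\<close>.\<close>
  define R where "R t i = (if x t i = 0 then 1 else x t i)" for t i
  \<comment> \<open>The degree does not depend on the roots, so \<open>E\<close> sums over a fixed
    range and the limit can be taken term by term.\<close>
  define d where "d = card (factor_choices m)"
  define E where "E s = (\<Sum>k\<le>d. coeff (choice_poly m c s) k *
      det (toeplitz_mat (laurent_coeff m (paired_poly m c s)) (n + k)))" for s
  have lim: "((\<lambda>t. R t i) \<longlongrightarrow> r i) (at 0)" for i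
  proof -
    have x: "((\<lambda>t. x t i) \<longlongrightarrow> r i) (at 0)"
      unfolding x_def by (auto intro!: tendsto_eq_intros)
    have "eventually (\<lambda>t. x t i \<noteq> 0) (at 0)"
      using tendsto_imp_eventually_ne[OF x nz] .
    hence "eventually (\<lambda>t. x t i = R t i) (at 0)"
      by eventually_elim (simp add: R_def)
    thus ?thesis using x by (rule Lim_transform_eventually[rotated])
  qed
  have lim_E: "((\<lambda>t. E (R t)) \<longlongrightarrow> E r) (at 0)"
  proof -
    have "((\<lambda>t. pair_factor (R t) i j) \<longlongrightarrow> pair_factor r i j) (at 0)" for i j
      unfolding pair_factor_def using lim nz by (auto intro!: tendsto_intros)
    hence "((\<lambda>t. coeff (choice_poly m c (R t)) k) \<longlongrightarrow> coeff (choice_poly m c r) k) (at 0)" for k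
      unfolding choice_poly_def using finite_factor_choices
      by (intro tendsto_coeff_prod_linear tendsto_intros)
    moreover have "((\<lambda>t. paired_roots (R t) l) \<longlongrightarrow> paired_roots r l) (at 0)" for l
      unfolding paired_roots_def using lim nz by (auto intro!: tendsto_intros)
    hence "((\<lambda>t. coeff (paired_poly m c (R t)) k) \<longlongrightarrow> coeff (paired_poly m c r) k) (at 0)" for k
      unfolding paired_poly_def coeff_smult
      by (intro tendsto_coeff_prod_linear tendsto_intros) auto
    hence "((\<lambda>t. laurent_coeff m (paired_poly m c (R t)) s)
        \<longlongrightarrow> laurent_coeff m (paired_poly m c r) s) (at 0)" for s
      by (auto simp: laurent_coeff_def)
    ultimately show ?thesis
      unfolding E_def by (intro tendsto_intros tendsto_det_toeplitz)
  qed
  \<comment> \<open>The slopes \<open>i\<close> are nonzero and pairwise distinct on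
    \<open>{1..<m}\<close>, so each condition below comes from a polynomial in \<open>t\<close> with
    nonzero leading coefficient.\<close>
  have "eventually (\<lambda>t. \<forall>i\<in>{1..<m}. \<forall>j\<in>{1..<m}.
      x t i \<noteq> 0 \<and> (i \<noteq> j \<longrightarrow> x t i \<noteq> x t j) \<and> x t i * x t j \<noteq> 1) (at 0)"
  proof (intro eventually_ball_finite ballI)
    fix i j assume ij: "i \<in> {1..<m}" "j \<in> {1..<m}"
    have "eventually (\<lambda>t. poly [:r i, of_nat i:] t \<noteq> 0) (at 0)"
      using ij by (intro eventually_poly_nonzero_at) auto
    moreover have "eventually (\<lambda>t. i \<noteq> j \<longrightarrow> poly [:r i - r j, of_nat i - of_nat j:] t \<noteq> 0) (at 0)"
      using eventually_poly_nonzero_at[of "[:r i - r j, of_nat i - of_nat j:]" 0] by (cases "i = j") auto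
    moreover have "eventually (\<lambda>t. poly [:r i * r j - 1, r i * of_nat j + of_nat i * r j, of_nat i * of_nat j:] t \<noteq> 0) (at 0)"
      using ij by (intro eventually_poly_nonzero_at) auto
    ultimately show "eventually (\<lambda>t. x t i \<noteq> 0 \<and> (i \<noteq> j \<longrightarrow> x t i \<noteq> x t j) \<and> x t i * x t j \<noteq> 1) (at 0)"
      by eventually_elim (auto simp: x_def algebra_simps)
  qed auto
  hence "eventually (\<lambda>t. E (R t) = 0) (at 0)"
  proof eventually_elim
    case (elim t)
    have "inj_on (paired_roots (R t)) {..<2 * m}"
      using elim by (intro inj_on_paired_roots) (auto simp: R_def)
    from toeplitz_recurrence_generic[OF assms(1) _ this, of c n] show "E (R t) = 0"
      by (simp add: E_def degree_choice_poly d_def R_def)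
  qed
  hence "((\<lambda>t. E (R t)) \<longlongrightarrow> 0) (at 0)" by (rule tendsto_eventually)
  from tendsto_unique[OF _ lim_E this] have "E r = 0" by simp
  thus ?thesis by (simp add: E_def degree_choice_poly d_def P_def)
qed

section \<open>Factorization of palindromic and antipalindromic polynomials\<close>

text \<open>Reflection pairs a root \<open>r\<close> with \<open>1/r\<close>. The delicate case is
  \<open>r = 1/r\<close>, where the even degree forces a double root.\<close>

lemma palindromic_quadratic_factor:
  fixes Q :: "complex poly"
  assumes deg: "degree Q = 2 * Suc k" and pal: "reflect_poly Q = Q"
  obtains r Q' where "r \<noteq> 0" and "Q = [:- r, 1:] * [:- inverse r, 1:] * Q'"
proof -
  have Q: "Q \<noteq> 0" using deg by auto
  have "\<not> constant (poly Q)" using deg constant_degree[of Q] by simp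
  then obtain r where r: "poly Q r = 0" using fundamental_theorem_of_algebra by blast
  \<comment> \<open>Constant and leading coefficient agree, so \<open>0\<close> is not a
    root.\<close>
  have "poly Q 0 = lead_coeff Q" using pal by (metis poly_reflect_poly_0)
  hence r0: "r \<noteq> 0" using r Q by auto
  from r obtain Q1 where Q1: "Q = [:- r, 1:] * Q1" by (metis dvdE poly_eq_0_iff_dvd)
  have "poly Q1 (inverse r) = 0"
  proof (cases "r = inverse r")
    case False
    have "poly Q r = r ^ degree Q * poly Q (inverse r)"
      using poly_reflect_poly_nz[OF r0, of Q] pal by simp
    hence "poly Q (inverse r) = 0" using r r0 by simp
    thus ?thesis using False by (simp add: Q1)
  next
    case True
    \<comment> \<open>Since \<open>r^2 = 1\<close>, reflecting the linear factor multiplies it by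
      \<open>- r\<close>, whence \<open>Q1\<close> is \<open>- r\<close> times its reflection. As
      \<open>Q1\<close> has odd degree, evaluation at \<open>r\<close> yields
      \<open>Q1(r) = - Q1(r)\<close>.\<close>
    hence rr: "r * r = 1" using r0 by (metis right_inverse)
    have "reflect_poly [:- r, 1:] = [:1, - r:]" using r0 by (simp add: reflect_poly_pCons)
    also have "\<dots> = smult (- r) [:- r, 1:]" using rr by simp
    finally have "reflect_poly [:- r, 1:] = smult (- r) [:- r, 1:]" .
    moreover have "reflect_poly [:- r, 1:] * reflect_poly Q1 = [:- r, 1:] * Q1"
      using pal by (simp only: Q1 reflect_poly_mult)
    ultimately have "[:- r, 1:] * Q1 = [:- r, 1:] * smult (- r) (reflect_poly Q1)"
      by (metis mult_smult_left mult_smult_right)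
    hence "Q1 = smult (- r) (reflect_poly Q1)"
      by (subst (asm) mult_left_cancel) auto
    hence "poly Q1 r = - r * poly (reflect_poly Q1) r" by (metis poly_smult)
    also have "\<dots> = - (r * r ^ degree Q1) * poly Q1 r"
      using poly_reflect_poly_nz[OF r0, of Q1] True by simp
    also have "degree Q1 = 2 * k + 1"
    proof -
      have "Q1 \<noteq> 0" using Q Q1 by auto
      hence "degree Q = degree [:- r, 1:] + degree Q1"
        unfolding Q1 by (intro degree_mult_eq) auto
      thus ?thesis using deg by simp
    qed
    also have "r * r ^ (2 * k + 1) = r ^ (2 * Suc k)" by simp
    also have "\<dots> = (r * r) ^ Suc k" by (simp only: power_mult power2_eq_square)
    also have "\<dots> = 1" by (simp only: rr power_one)
    finally have "poly Q1 r = 0" by simp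
    thus ?thesis using True by simp
  qed
  then obtain Q2 where Q2: "Q1 = [:- inverse r, 1:] * Q2" by (metis dvdE poly_eq_0_iff_dvd)
  have "Q = [:- r, 1:] * [:- inverse r, 1:] * Q2" unfolding Q1 Q2 by (rule mult.assoc[symmetric])
  with r0 show ?thesis by (rule that)
qed

text \<open>Induction on \<open>k\<close>: the quadratic factor split off is itself palindromic, so
  cancelling it leaves a palindromic quotient.\<close>

lemma palindromic_poly_factorization:
  fixes Q :: "complex poly"
  assumes "degree Q = 2 * k" and "reflect_poly Q = Q"
  shows "\<exists>r. (\<forall>i. r i \<noteq> 0) \<and>
    Q = smult (lead_coeff Q) (\<Prod>i<k. [:- r i, 1:] * [:- inverse (r i), 1:])"
  using assms
proof (induction k arbitrary: Q)
  case 0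
  thus ?case by (intro exI[of _ "\<lambda>_. 1"]) (auto elim: degree_eq_zeroE)
next
  case (Suc k)
  obtain x Q' where x: "x \<noteq> 0" and Q: "Q = [:- x, 1:] * [:- inverse x, 1:] * Q'"
    using palindromic_quadratic_factor[OF Suc.prems] .
  define F where "F = [:- x, 1:] * [:- inverse x, 1:]"
  have F: "F = [:1, - (x + inverse x), 1:]" using x by (simp add: F_def)
  have F_facts: "F \<noteq> 0" "degree F = 2" "lead_coeff F = 1" by (simp_all add: F)
  have "reflect_poly F = F" by (simp add: F reflect_poly_pCons)
  hence "F * reflect_poly Q' = F * Q'"
    using Suc.prems(2) unfolding Q F_def[symmetric] reflect_poly_mult by simp
  hence pal': "reflect_poly Q' = Q'" using F_facts(1) by simp
  have "Q' \<noteq> 0" using Suc.prems(1) Q by auto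
  hence "degree Q = degree F + degree Q'"
    unfolding Q F_def[symmetric] using F_facts(1) by (intro degree_mult_eq)
  hence "degree Q' = 2 * k" using Suc.prems(1) F_facts(2) by simp
  from Suc.IH[OF this pal'] obtain r where r: "\<And>i. r i \<noteq> 0"
    "Q' = smult (lead_coeff Q') (\<Prod>i<k. [:- r i, 1:] * [:- inverse (r i), 1:])" by blast
  have lc: "lead_coeff Q = lead_coeff Q'"
    unfolding Q F_def[symmetric] lead_coeff_mult F_facts(3) by simp
  have "Q = F * smult (lead_coeff Q') (\<Prod>i<k. [:- r i, 1:] * [:- inverse (r i), 1:])"
    unfolding r(2)[symmetric] by (simp only: Q F_def)
  also have "\<dots> = smult (lead_coeff Q) (\<Prod>i<Suc k. [:- (r(k := x)) i, 1:] * [:- inverse ((r(k := x)) i), 1:])"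
    by (simp add: lc F_def mult.commute)
  finally show ?case using r(1) x by (intro exI[of _ "r(k := x)"]) auto
qed

text \<open>Antisymmetry forces the root \<open>1\<close> and, the degree being even, also
  \<open>-1\<close>. Since \<open>z^2 - 1\<close> is antipalindromic, the quotient by it is
  palindromic.\<close>

lemma antipalindromic_poly_factorization:
  fixes P :: "complex poly"
  assumes deg: "degree P = 2 * m" and "m \<ge> 1" and anti: "reflect_poly P = - P"
  shows "\<exists>r. (\<forall>i. r i \<noteq> 0) \<and> P = paired_poly m (lead_coeff P) r"
proof -
  obtain k where m: "m = Suc k" using \<open>m \<ge> 1\<close> by (cases m) auto
  have P: "P \<noteq> 0" using deg m by auto
  have "poly P 1 = 0" using poly_reflect_poly_nz[of 1 P] anti by simp
  then obtain P1 where P1: "P = [:- 1, 1:] * P1" by (metis dvdE poly_eq_0_iff_dvd)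
  have "poly P (- 1) = 0" using poly_reflect_poly_nz[of "- 1" P] anti deg by simp
  hence "poly P1 (- 1) = 0" by (simp add: P1)
  then obtain Q where Q: "P1 = [:1, 1:] * Q" by (metis dvdE poly_eq_0_iff_dvd minus_minus)
  define F :: "complex poly" where "F = [:- 1, 0, 1:]"
  have PF: "P = F * Q" by (simp add: P1 Q F_def flip: mult.assoc)
  have "reflect_poly F = - F" by (simp add: F_def reflect_poly_pCons)
  hence "F * reflect_poly Q = F * Q"
    using anti unfolding PF reflect_poly_mult by simp
  moreover have "F \<noteq> 0" by (simp add: F_def)
  ultimately have pal: "reflect_poly Q = Q" by simp
  have "Q \<noteq> 0" using P PF by auto
  hence "degree P = degree F + degree Q"
    unfolding PF by (intro degree_mult_eq) (simp_all add: F_def)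
  hence "degree Q = 2 * k" using deg m by (simp add: F_def)
  from palindromic_poly_factorization[OF this pal] obtain r where r: "\<And>i. r i \<noteq> 0"
    "Q = smult (lead_coeff Q) (\<Prod>i<k. [:- r i, 1:] * [:- inverse (r i), 1:])" by blast
  \<comment> \<open>Pair \<open>0\<close> of \<open>paired_roots\<close> is taken by
    \<open>1\<close> and \<open>-1\<close>, so the other pairs move up by one index.\<close>
  define r' where "r' i = r (i - 1)" for i
  have split: "(\<Prod>l<2 * n. f l) = (\<Prod>i<n. f (2 * i) * f (Suc (2 * i)))" for n and f :: "nat \<Rightarrow> complex poly"
    by (induction n) (simp_all add: mult.assoc)
  have lc: "lead_coeff P = lead_coeff Q" unfolding PF lead_coeff_mult by (simp add: F_def)
  have "(\<Prod>l<2 * m. [:- paired_roots r' l, 1:])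
      = F * (\<Prod>i<k. [:- r i, 1:] * [:- inverse (r i), 1:])"
    unfolding split m prod.lessThan_Suc_shift by (simp add: paired_roots_def r'_def F_def)
  hence "paired_poly m (lead_coeff P) r' = F * smult (lead_coeff Q) (\<Prod>i<k. [:- r i, 1:] * [:- inverse (r i), 1:])"
    by (simp add: paired_poly_def lc)
  also have "\<dots> = P" unfolding r(2)[symmetric] PF ..
  finally show ?thesis using r(1) by (intro exI[of _ r']) (simp add: r'_def)
qed

section \<open>Recurrence for skew-symmetric Toeplitz determinants\<close>

text \<open>The case of exact bandwidth: \<open>top\<close> makes the degree of \<open>P\<close>
  exactly \<open>2 * m\<close>, so reflecting \<open>P\<close> exchanges the entries at
  \<open>s\<close> and \<open>- s\<close>, and skew symmetry makes \<open>P\<close>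
  antipalindromic.\<close>

lemma skew_toeplitz_recurrence:
  fixes a :: "int \<Rightarrow> complex"
  assumes "m \<ge> 1" and skew: "\<And>s. a (- s) = - a s" and top: "a (int m) \<noteq> 0"
    and band: "\<And>s. \<bar>s\<bar> > int m \<Longrightarrow> a s = 0"
  shows "\<exists>c. annihilating_recurrence (2 * 3 ^ (m - 1)) c (\<lambda>n. det (toeplitz_mat a n))"
proof -
  define P where "P = (\<Sum>k\<le>2 * m. monom (a (int k - int m)) k)"
  have cP: "coeff P k = (if k \<le> 2 * m then a (int k - int m) else 0)" for k
    by (auto simp: P_def coeff_sum coeff_monom)
  have deg: "degree P = 2 * m"
  proof (rule antisym)
    show "degree P \<le> 2 * m" by (rule degree_le) (simp add: cP)
    show "2 * m \<le> degree P" by (rule le_degree) (simp add: cP top)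
  qed
  have "reflect_poly P = - P"
  proof (rule poly_eqI)
    fix k
    have "a (int (2 * m - k) - int m) = - a (int k - int m)" if "k \<le> 2 * m"
      using that skew[of "int k - int m"] by (simp add: of_nat_diff)
    thus "coeff (reflect_poly P) k = coeff (- P) k"
      by (simp add: coeff_reflect_poly deg cP)
  qed
  from antipalindromic_poly_factorization[OF deg assms(1) this] obtain r where
    r: "\<And>i. r i \<noteq> 0" "P = paired_poly m (lead_coeff P) r" by blast
  have "laurent_coeff m P s = a s" for s
    using band[of s] by (auto simp: laurent_coeff_def cP)
  hence a: "laurent_coeff m (paired_poly m (lead_coeff P) r) = a"
    using r(2) by auto
  show ?thesis
    using annihilating_recurrence_monic[OF lead_coeff_choice_poly
        toeplitz_recurrence_paired[of m r "lead_coeff P", OF assms(1) r(1)]]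
    unfolding a degree_choice_poly card_factor_choices[OF assms(1)] by blast
qed

theorem theorem3p11:
  fixes m :: nat and a :: "int \<Rightarrow> complex"
  assumes "m \<ge> 1"
    and "a 0 = 0"
    and "\<And>j. 1 \<le> j \<Longrightarrow> j \<le> int m \<Longrightarrow> a (- j) = - a j"
    and "\<And>s. \<bar>s\<bar> > int m \<Longrightarrow> a s = 0"
  shows "\<exists>d c. d \<le> 2 * 3 ^ (m - 1) \<and>
           annihilating_recurrence d c (\<lambda>n. det (toeplitz_mat a n))"
proof -
  have skew: "a (- s) = - a s" for s
  proof -
    consider "s = 0" | "1 \<le> s" "s \<le> int m" | "1 \<le> - s" "- s \<le> int m" | "\<bar>s\<bar> > int m" by linarith
    thus ?thesis
      using assms(2,4) assms(3)[of s] assms(3)[of "- s"] by cases auto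
  qed
  \<comment> \<open>The maximum of \<open>J\<close>, if there is one, is the true bandwidth; the
    bound is monotone in it.\<close>
  define J where "J = {j. 1 \<le> j \<and> j \<le> m \<and> a (int j) \<noteq> 0}"
  have fin: "finite J" by (rule finite_subset[of _ "{..m}"]) (auto simp: J_def)
  show ?thesis
  proof (cases "J = {}")
    case True
    have nonneg: "a (int j) = 0" for j
      using True assms(2) assms(4)[of "int j"] by (cases "j = 0"; cases "j \<le> m") (auto simp: J_def)
    have "a s = 0" for s
      using nonneg[of "nat s"] nonneg[of "nat (- s)"] skew[of s] by (cases "s \<ge> 0") auto
    hence "toeplitz_mat a n = 0\<^sub>m n n" for n
      by (auto simp: toeplitz_mat_def)
    \<comment> \<open>All determinants vanish except the one for \<open>n = 0\<close>, which is
      \<open>1\<close>; hence degree \<open>1\<close> and not \<open>0\<close>.\<close>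
    hence "annihilating_recurrence 1 (\<lambda>_. 0) (\<lambda>n. det (toeplitz_mat a n))"
      by (simp add: annihilating_recurrence_def)
    moreover have "(1::nat) \<le> 2 * 3 ^ (m - 1)" by simp
    ultimately show ?thesis by blast
  next
    case False
    define m' where "m' = Max J"
    have m': "1 \<le> m'" "m' \<le> m" "a (int m') \<noteq> 0"
      using Max_in[OF fin False] by (auto simp: J_def m'_def)
    have pos: "a (int j) = 0" if "j > m'" for j
    proof -
      have "j \<notin> J" using that Max_ge[OF fin, of j] by (auto simp: m'_def)
      thus ?thesis using that assms(4)[of "int j"] by (cases "j \<le> m") (auto simp: J_def)
    qed
    have "a s = 0" if "\<bar>s\<bar> > int m'" for s
      using that pos[of "nat s"] pos[of "nat (- s)"] skew[of s] by (cases "s \<ge> 0") auto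
    from skew_toeplitz_recurrence[OF m'(1) skew m'(3) this]
    obtain c where "annihilating_recurrence (2 * 3 ^ (m' - 1)) c (\<lambda>n. det (toeplitz_mat a n))"
      by blast
    moreover have "2 * 3 ^ (m' - 1) \<le> (2 * 3 ^ (m - 1) :: nat)"
      using m' by (intro mult_left_mono power_increasing) auto
    ultimately show ?thesis by blast
  qed
qed

end
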